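(* Let $C>1$. There is $\gamma_0>0$ such that for every $\gamma>\gamma_0$ the following holds. Let $\bar u\in U_{ad}$, with state $\bar y=S\bar u+y_f$, satisfy the KKT system: there exist $\bar\phi\in H_0^1(\Omega)\cap L^\infty(\Omega)$, $\bar\zeta\in L^\infty(\Omega)$ and $\lambda_a,\lambda_b\in L^2(\Omega)$ such that $$A^*\bar\phi=\bar y-y_d\ \text{in }\Omega,\quad\bar\phi=0\ \text{on }\Gamma,\qquad \bar\phi+\alpha\bar u+\beta(\delta_\gamma\bar\zeta-\bar w)+\lambda_b-\lambda_a=0,$$ $$\lambda_a\ge0,\quad\lambda_b\ge0,\quad\lambda_a(\bar u-u_a)=0,\quad\lambda_b(u_b-\bar u)=0,$$ $\bar\zeta(x)=1$ if $\bar u(x)>0$, $\bar\zeta(x)=-1$ if $\bar u(x)<0$, $|\bar\zeta(x)|\le1$ if $\bar u(x)=0$ (for a.a. $x\in\Omega$), where $\bar w(x)=j(\bar u(x))$. Assume moreover that $$|\bar u(x)|\ge C s^*+\frac{1-q}{\gamma}\quad\text{for almost all }x\in\Omega\text{ with }\bar u(x)\neq0,\qquad s^*=\Big(\frac\beta\alpha q(1-q)\Big)^{\frac1{2-q}}.$$ Then there exist constants $\varrho>0$ and $\sigma>0$ such that $$\sigma\|u-\bar u\|_{L^2(\Omega)}^2\le J_\gamma(u)-J_\gamma(\bar u)\qquad\text{for all }u\in B_\infty(\varrho,\bar u)\cap U_{ad},$$ where $B_\infty(\varrho,\bar u)$ is the ball of radius $\varrho$ centered at $\bar u$ in $L^\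infty(\Omega)$.
   Context: Setting. $\Omega\subset\mathbb R^2$ is a bounded star-shaped domain with boundary $\Gamma$; $y_d\in L^p(\Omega)$ with $p>2$; $f\in L^2(\Omega)$; $\alpha,\beta>0$, $q\in(0,1)$; $\gamma>1$ is a (large) regularization parameter; $u_a<0<u_b$ are reals. $A$ is the operator $Ay=-\sum_{i,j=1}^2\partial_{x_i}(a_{ij}\partial_{x_j}y)+c_0y$ with $a_{ij}\in C(\bar\Omega)$, $(a_{ij})$ symmetric and uniformly elliptic, $0\le c_0\in L^\infty(\Omega)$; $A^*$ is its formal adjoint, equations being understood in the weak sense. $S:L^2(\Omega)\to H_0^1(\Omega)$ maps $w$ to the weak solution $y$ of $Ay=w$ in $\Omega$, $y=0$ on $\Gamma$; $y_f=Sf$. $S$ and its adjoint are continuous from $L^2(\Omega)$ to $L^\infty(\Omega)$. $U_{ad}=\{u\in L^2(\Omega):u_a\le u(x)\le u_b\text{ a.e.}\}$. $\delta_\gamma=q^q\gamma^{1-q}$. $\Upsilon_{q,\gamma}(u)=\int_\Omega h_{q,\gamma}(u(x))^q\,dx$, where $h_{q,\gamma}(t)=q\gamma^{\frac{1-q}q}|t|^{\frac1q}$ if $|t|\le\frac1\gamma$, and $h_{q,\gamma}(t)=|t|-\frac{1-q}\gamma$ otherwise. $j:\mathbb R\to\mathbb R$ is $j(t)=\big[\delta_\gamma-q\big(|t|+\frac{q-1}\gamma\big)^{q-1}\big]\operatorname{sign}(t)$ if $|t|>\frac1\gamma$ and $j(t)=0$ otherwise. The cost is $J_\gamma(u)=\frac12\|Su+y_f-y_d\|_{L^2(\Omega)}^2+\frac\alpha2\|u\|_{L^2(\Omega)}^2+\beta\Upsilon_{q,\gamma}(u)$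 (which equals the paper's $J_\gamma(y,u)$ with $y=Su+y_f$). *)

theory Defs
  imports "HOL-Analysis.Analysis" "HOL-Probability.Essential_Supremum"
begin

section \<open>Lebesgue spaces on a domain\<close>

text \<open>Elements of the Lebesgue spaces are represented by functions on the whole plane, of which only
  the values on \<open>\<Omega>\<close> matter.  Functions that agree almost everywhere are not identified.\<close>

definition Lp :: "(real^2) set \<Rightarrow> real \<Rightarrow> (real^2 \<Rightarrow> real) set" where
  "Lp \<Omega> p = {u \<in> borel_measurable (lebesgue_on \<Omega>).
     integrable (lebesgue_on \<Omega>) (\<lambda>x. \<bar>u x\<bar> powr p)}"

abbreviation L2 :: "(real^2) set \<Rightarrow> (real^2 \<Rightarrow> real) set" where
  "L2 \<Omega> \<equiv> Lp \<Omega> 2"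

definition L2_inner :: "(real^2) set \<Rightarrow> (real^2 \<Rightarrow> real) \<Rightarrow> (real^2 \<Rightarrow> real) \<Rightarrow> real" where
  "L2_inner \<Omega> u v = (\<integral>x. u x * v x \<partial>lebesgue_on \<Omega>)"

definition L2_norm :: "(real^2) set \<Rightarrow> (real^2 \<Rightarrow> real) \<Rightarrow> real" where
  "L2_norm \<Omega> u = sqrt (\<integral>x. (u x)\<^sup>2 \<partial>lebesgue_on \<Omega>)"

definition Linf_norm :: "(real^2) set \<Rightarrow> (real^2 \<Rightarrow> real) \<Rightarrow> ereal" where
  "Linf_norm \<Omega> u = esssup (lebesgue_on \<Omega>) (\<lambda>x. ereal \<bar>u x\<bar>)"

definition Linf :: "(real^2) set \<Rightarrow> (real^2 \<Rightarrow> real) set" where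
  "Linf \<Omega> = {u \<in> borel_measurable (lebesgue_on \<Omega>). Linf_norm \<Omega> u < \<infinity>}"

definition Linf_ball :: "(real^2) set \<Rightarrow> real \<Rightarrow> (real^2 \<Rightarrow> real) \<Rightarrow> (real^2 \<Rightarrow> real) set" where
  "Linf_ball \<Omega> r u = {v \<in> Linf \<Omega>. Linf_norm \<Omega> (\<lambda>x. v x - u x) \<le> ereal r}"


section \<open>The space \<open>H\<^sub>0\<^sup>1\<close>\<close>

definition partial :: "2 \<Rightarrow> (real^2 \<Rightarrow> real) \<Rightarrow> real^2 \<Rightarrow> real" where
  "partial i u x = frechet_derivative u (at x) (axis i 1)"

primrec Ck :: "nat \<Rightarrow> (real^2 \<Rightarrow> real) \<Rightarrow> bool" where
  "Ck 0 u \<longleftrightarrow> continuous_on UNIV u"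
| "Ck (Suc k) u \<longleftrightarrow> (\<forall>x. u differentiable (at x)) \<and> (\<forall>i. Ck k (partial i u))"

definition test_functions :: "(real^2) set \<Rightarrow> (real^2 \<Rightarrow> real) set" where
  "test_functions \<Omega> = {\<psi>. (\<forall>k. Ck k \<psi>) \<and>
     compact (closure {x. \<psi> x \<noteq> 0}) \<and> closure {x. \<psi> x \<noteq> 0} \<subseteq> \<Omega>}"

text \<open>\<open>g\<close> is a square integrable weak gradient of \<open>u\<close>; it is determined by \<open>u\<close> up to null sets.\<close>

definition has_weak_gradient ::
    "(real^2) set \<Rightarrow> (real^2 \<Rightarrow> real) \<Rightarrow> (real^2 \<Rightarrow> real^2) \<Rightarrow> bool" where
  "has_weak_gradient \<Omega> u g \<longleftrightarrow> (\<forall>i. (\<lambda>x. g x $ i) \<in> L2 \<Omega>) \<and>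
     (\<forall>\<psi>\<in>test_functions \<Omega>. \<forall>i. L2_inner \<Omega> u (partial i \<psi>) = - L2_inner \<Omega> (\<lambda>x. g x $ i) \<psi>)"

definition H1 :: "(real^2) set \<Rightarrow> (real^2 \<Rightarrow> real) set" where
  "H1 \<Omega> = {u \<in> L2 \<Omega>. \<exists>g. has_weak_gradient \<Omega> u g}"

text \<open>The closure of the test functions with respect to the norm of \<open>H\<^sup>1\<close>; this encodes the
  homogeneous Dirichlet condition on the boundary of \<open>\<Omega>\<close>.\<close>

definition H01 :: "(real^2) set \<Rightarrow> (real^2 \<Rightarrow> real) set" where
  "H01 \<Omega> = {u \<in> H1 \<Omega>. \<exists>g. has_weak_gradient \<Omega> u g \<and>
     (\<exists>\<psi>. (\<forall>n::nat. \<psi> n \<in> test_functions \<Omega>) \<and>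
       (\<lambda>n. L2_norm \<Omega> (\<lambda>x. \<psi> n x - u x)) \<longlonglongrightarrow> 0 \<and>
       (\<forall>i. (\<lambda>n. L2_norm \<Omega> (\<lambda>x. partial i (\<psi> n) x - g x $ i)) \<longlonglongrightarrow> 0))}"


section \<open>The elliptic equation\<close>

definition uniformly_elliptic :: "(real^2) set \<Rightarrow> (real^2 \<Rightarrow> real^2^2) \<Rightarrow> bool" where
  "uniformly_elliptic \<Omega> a \<longleftrightarrow>
     (\<exists>\<kappa>>0. \<forall>x\<in>closure \<Omega>. \<forall>\<xi>. (\<Sum>i\<in>UNIV. \<Sum>j\<in>UNIV. a x $ i $ j * \<xi> $ i * \<xi> $ j) \<ge> \<kappa> * (norm \<xi>)\<^sup>2)"

text \<open>The bilinear form of \<open>A\<close>, evaluated at functions \<open>y\<close> and \<open>v\<close> with weak gradients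
  \<open>gy\<close> and \<open>gv\<close>.\<close>

definition bilinear_form :: "(real^2) set \<Rightarrow> (real^2 \<Rightarrow> real^2^2) \<Rightarrow> (real^2 \<Rightarrow> real) \<Rightarrow>
    (real^2 \<Rightarrow> real) \<Rightarrow> (real^2 \<Rightarrow> real^2) \<Rightarrow> (real^2 \<Rightarrow> real) \<Rightarrow> (real^2 \<Rightarrow> real^2) \<Rightarrow> real" where
  "bilinear_form \<Omega> a c\<^sub>0 y gy v gv =
     (\<integral>x. (\<Sum>i\<in>UNIV. \<Sum>j\<in>UNIV. a x $ i $ j * gy x $ j * gv x $ i) + c\<^sub>0 x * y x * v x
       \<partial>lebesgue_on \<Omega>)"

definition weak_solution :: "(real^2) set \<Rightarrow> (real^2 \<Rightarrow> real^2^2) \<Rightarrow> (real^2 \<Rightarrow> real) \<Rightarrow>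
    (real^2 \<Rightarrow> real) \<Rightarrow> (real^2 \<Rightarrow> real) \<Rightarrow> bool" where
  "weak_solution \<Omega> a c\<^sub>0 w y \<longleftrightarrow> y \<in> H01 \<Omega> \<and>
     (\<exists>gy. has_weak_gradient \<Omega> y gy \<and>
       (\<forall>v\<in>H01 \<Omega>. \<forall>gv. has_weak_gradient \<Omega> v gv \<longrightarrow>
         bilinear_form \<Omega> a c\<^sub>0 y gy v gv = L2_inner \<Omega> w v))"

text \<open>The formal adjoint of \<open>A\<close> has the transposed coefficient matrix.\<close>

definition adjoint_weak_solution :: "(real^2) set \<Rightarrow> (real^2 \<Rightarrow> real^2^2) \<Rightarrow> (real^2 \<Rightarrow> real) \<Rightarrow>
    (real^2 \<Rightarrow> real) \<Rightarrow> (real^2 \<Rightarrow> real) \<Rightarrow> bool" where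
  "adjoint_weak_solution \<Omega> a = weak_solution \<Omega> (\<lambda>x. transpose (a x))"

definition solution_operator :: "(real^2) set \<Rightarrow> (real^2 \<Rightarrow> real^2^2) \<Rightarrow> (real^2 \<Rightarrow> real) \<Rightarrow>
    ((real^2 \<Rightarrow> real) \<Rightarrow> real^2 \<Rightarrow> real) \<Rightarrow> bool" where
  "solution_operator \<Omega> a c\<^sub>0 S \<longleftrightarrow> (\<forall>w\<in>L2 \<Omega>. weak_solution \<Omega> a c\<^sub>0 w (S w))"

definition L2_adjoint :: "(real^2) set \<Rightarrow> ((real^2 \<Rightarrow> real) \<Rightarrow> real^2 \<Rightarrow> real) \<Rightarrow>
    ((real^2 \<Rightarrow> real) \<Rightarrow> real^2 \<Rightarrow> real) \<Rightarrow> bool" where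
  "L2_adjoint \<Omega> S T \<longleftrightarrow>
     (\<forall>v\<in>L2 \<Omega>. T v \<in> L2 \<Omega> \<and> (\<forall>u\<in>L2 \<Omega>. L2_inner \<Omega> (S u) v = L2_inner \<Omega> u (T v)))"

text \<open>Boundedness, that is, continuity, of a linear operator from \<open>L\<^sup>2\<close> to \<open>L\<^sup>\<infinity>\<close>.\<close>

definition bounded_L2_Linf ::
    "(real^2) set \<Rightarrow> ((real^2 \<Rightarrow> real) \<Rightarrow> real^2 \<Rightarrow> real) \<Rightarrow> bool" where
  "bounded_L2_Linf \<Omega> T \<longleftrightarrow>
     (\<exists>K. \<forall>w\<in>L2 \<Omega>. T w \<in> Linf \<Omega> \<and> Linf_norm \<Omega> (T w) \<le> ereal (K * L2_norm \<Omega> w))"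


section \<open>The regularized control problem\<close>

definition U_ad :: "(real^2) set \<Rightarrow> real \<Rightarrow> real \<Rightarrow> (real^2 \<Rightarrow> real) set" where
  "U_ad \<Omega> u\<^sub>a u\<^sub>b = {u \<in> L2 \<Omega>. AE x in lebesgue_on \<Omega>. u\<^sub>a \<le> u x \<and> u x \<le> u\<^sub>b}"

definition delta :: "real \<Rightarrow> real \<Rightarrow> real" where
  "delta q \<gamma> = q powr q * \<gamma> powr (1 - q)"

definition h_reg :: "real \<Rightarrow> real \<Rightarrow> real \<Rightarrow> real" where
  "h_reg q \<gamma> t = (if \<bar>t\<bar> \<le> 1 / \<gamma> then q * \<gamma> powr ((1 - q) / q) * \<bar>t\<bar> powr (1 / q)
                 else \<bar>t\<bar> - (1 - q) / \<gamma>)"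

definition Upsilon :: "(real^2) set \<Rightarrow> real \<Rightarrow> real \<Rightarrow> (real^2 \<Rightarrow> real) \<Rightarrow> real" where
  "Upsilon \<Omega> q \<gamma> u = (\<integral>x. h_reg q \<gamma> (u x) powr q \<partial>lebesgue_on \<Omega>)"

definition j_reg :: "real \<Rightarrow> real \<Rightarrow> real \<Rightarrow> real" where
  "j_reg q \<gamma> t = (if \<bar>t\<bar> > 1 / \<gamma>
     then (delta q \<gamma> - q * (\<bar>t\<bar> + (q - 1) / \<gamma>) powr (q - 1)) * sgn t else 0)"

definition s_star :: "real \<Rightarrow> real \<Rightarrow> real \<Rightarrow> real" where
  "s_star \<alpha> \<beta> q = (\<beta> / \<alpha> * (q * (1 - q))) powr (1 / (2 - q))"

definition state :: "((real^2 \<Rightarrow> real) \<Rightarrow> real^2 \<Rightarrow> real) \<Rightarrow> (real^2 \<Rightarrow> real) \<Rightarrow>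
    (real^2 \<Rightarrow> real) \<Rightarrow> real^2 \<Rightarrow> real" where
  "state S f u x = S u x + S f x"

definition cost :: "(real^2) set \<Rightarrow> ((real^2 \<Rightarrow> real) \<Rightarrow> real^2 \<Rightarrow> real) \<Rightarrow> (real^2 \<Rightarrow> real) \<Rightarrow>
    (real^2 \<Rightarrow> real) \<Rightarrow> real \<Rightarrow> real \<Rightarrow> real \<Rightarrow> real \<Rightarrow> (real^2 \<Rightarrow> real) \<Rightarrow> real" where
  "cost \<Omega> S f y\<^sub>d \<alpha> \<beta> q \<gamma> u =
     1 / 2 * (L2_norm \<Omega> (\<lambda>x. state S f u x - y\<^sub>d x))\<^sup>2
     + \<alpha> / 2 * (L2_norm \<Omega> u)\<^sup>2 + \<beta> * Upsilon \<Omega> q \<gamma> u"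

text \<open>The optimality system for the control \<open>u\<close> with adjoint state \<open>\<phi>\<close>, subgradient \<open>\<zeta>\<close> and
  multipliers \<open>\<mu>\<^sub>a\<close> and \<open>\<mu>\<^sub>b\<close> for the lower and the upper bound.\<close>

definition KKT :: "(real^2) set \<Rightarrow> (real^2 \<Rightarrow> real^2^2) \<Rightarrow> (real^2 \<Rightarrow> real) \<Rightarrow>
    ((real^2 \<Rightarrow> real) \<Rightarrow> real^2 \<Rightarrow> real) \<Rightarrow> (real^2 \<Rightarrow> real) \<Rightarrow> (real^2 \<Rightarrow> real) \<Rightarrow>
    real \<Rightarrow> real \<Rightarrow> real \<Rightarrow> real \<Rightarrow> real \<Rightarrow> real \<Rightarrow> (real^2 \<Rightarrow> real) \<Rightarrow>
    (real^2 \<Rightarrow> real) \<Rightarrow> (real^2 \<Rightarrow> real) \<Rightarrow> (real^2 \<Rightarrow> real) \<Rightarrow> (real^2 \<Rightarrow> real) \<Rightarrow> bool" where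
  "KKT \<Omega> a c\<^sub>0 S f y\<^sub>d \<alpha> \<beta> q \<gamma> u\<^sub>a u\<^sub>b u \<phi> \<zeta> \<mu>\<^sub>a \<mu>\<^sub>b \<longleftrightarrow>
     \<phi> \<in> H01 \<Omega> \<inter> Linf \<Omega> \<and> \<zeta> \<in> Linf \<Omega> \<and> \<mu>\<^sub>a \<in> L2 \<Omega> \<and> \<mu>\<^sub>b \<in> L2 \<Omega> \<and>
     adjoint_weak_solution \<Omega> a c\<^sub>0 (\<lambda>x. state S f u x - y\<^sub>d x) \<phi> \<and>
     (AE x in lebesgue_on \<Omega>.
        \<phi> x + \<alpha> * u x + \<beta> * (delta q \<gamma> * \<zeta> x - j_reg q \<gamma> (u x)) + \<mu>\<^sub>b x - \<mu>\<^sub>a x = 0 \<and>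
        \<mu>\<^sub>a x \<ge> 0 \<and> \<mu>\<^sub>b x \<ge> 0 \<and> \<mu>\<^sub>a x * (u x - u\<^sub>a) = 0 \<and> \<mu>\<^sub>b x * (u\<^sub>b - u x) = 0 \<and>
        (u x > 0 \<longrightarrow> \<zeta> x = 1) \<and> (u x < 0 \<longrightarrow> \<zeta> x = -1) \<and> (u x = 0 \<longrightarrow> \<bar>\<zeta> x\<bar> \<le> 1))"

end

theory Submission imports Defs
begin

text \<open>
  The tracking term is a convex function of the state, so it lies above its linearization at the state
  of \<open>u_bar\<close>, and the adjoint equation turns this linearization into the integral of
  \<open>\<phi> * (u - u_bar)\<close> (\<open>tracking_term_ge_linearization\<close>).  What remains is an integral whose integrand
  depends on \<open>u\<close> and \<open>u_bar\<close> only through their values at the point, and quadratic growth can be proved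
  for this integrand (\<open>pointwise_growth\<close>).

  After \<open>\<phi>\<close> is eliminated with the optimality system, the multipliers contribute a nonnegative term
  by complementarity, and the control cost contributes \<open>\<alpha> / 2 * (u - u_bar)\<^sup>2\<close>.  Only the remainder of
  the nonconvex sparsity term can spoil growth.  Where \<open>u_bar\<close> vanishes and \<open>u\<close> is at most \<open>1 / \<gamma>\<close> in
  modulus, the sparsity term is exactly \<open>delta q \<gamma> * \<bar>u\<bar>\<close>, whose remainder is nonnegative.  Where
  \<open>u_bar\<close> does not vanish, it is \<open>(\<bar>u\<bar> - (1 - q) / \<gamma>) powr q\<close>.  As long as the base of this power is at
  least \<open>c * s_star\<close>, its second derivative in \<open>u\<close>, multiplied by \<open>\<beta>\<close>, is at least
  \<open>- \<alpha> * c powr (q - 2)\<close> (\<open>curvature_at_multiple_of_s_star\<close>), and for \<open>1 < c\<close> this leaves a positive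
  part of \<open>\<alpha>\<close>.  Since \<open>C\<close> is larger than \<open>1\<close>, the lower bound on the nonzero values of \<open>u_bar\<close> leaves
  room for such a \<open>c\<close> on the whole segment between \<open>u_bar\<close> and \<open>u\<close> when these are uniformly close.
  Taking \<open>\<gamma>\<close> larger than \<open>1 / s_star\<close> keeps this segment beyond \<open>1 / \<gamma>\<close>, where the sparsity term has
  this form.
\<close>

section \<open>Square integrable functions on the domain\<close>

lemma L2_iff_square_integrable:
  "u \<in> L2 \<Omega> \<longleftrightarrow>
     u \<in> borel_measurable (lebesgue_on \<Omega>) \<and> integrable (lebesgue_on \<Omega>) (\<lambda>x. (u x)\<^sup>2)"
  by (simp add: Lp_def powr_numeral)

lemma L2_mult_integrable:
  assumes "u \<in> L2 \<Omega>" "v \<in> L2 \<Omega>"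
  shows "integrable (lebesgue_on \<Omega>) (\<lambda>x. u x * v x)"
proof (rule Bochner_Integration.integrable_bound)
  show "integrable (lebesgue_on \<Omega>) (\<lambda>x. (u x)\<^sup>2 + (v x)\<^sup>2)"
    using assms by (simp add: L2_iff_square_integrable)
  show "(\<lambda>x. u x * v x) \<in> borel_measurable (lebesgue_on \<Omega>)"
    using assms by (auto simp: L2_iff_square_integrable)
  have "\<bar>s * t\<bar> \<le> s\<^sup>2 + t\<^sup>2" for s t :: real
    using sum_squares_bound[of "\<bar>s\<bar>" "\<bar>t\<bar>"] abs_ge_zero[of "s * t"]
    unfolding abs_mult power2_abs by linarith
  then show "AE x in lebesgue_on \<Omega>. norm (u x * v x) \<le> norm ((u x)\<^sup>2 + (v x)\<^sup>2)"
    by simp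
qed

lemma L2_add:
  assumes "u \<in> L2 \<Omega>" "v \<in> L2 \<Omega>"
  shows "(\<lambda>x. u x + v x) \<in> L2 \<Omega>"
  using assms L2_mult_integrable[OF assms]
  by (auto simp: L2_iff_square_integrable power2_sum mult.assoc)

lemma L2_diff:
  assumes "u \<in> L2 \<Omega>" "v \<in> L2 \<Omega>"
  shows "(\<lambda>x. u x - v x) \<in> L2 \<Omega>"
  using assms L2_mult_integrable[OF assms]
  by (auto simp: L2_iff_square_integrable power2_diff mult.assoc)

lemma Lp_subset_L2:
  assumes "\<Omega> \<in> lmeasurable" "2 \<le> p"
  shows "Lp \<Omega> p \<subseteq> L2 \<Omega>"
proof
  fix u assume u: "u \<in> Lp \<Omega> p"
  interpret finite_measure "lebesgue_on \<Omega>"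
    using assms(1) by (rule finite_measure_lebesgue_on)
  have bound: "\<bar>t\<bar> powr 2 \<le> 1 + \<bar>t\<bar> powr p" for t :: real
  proof (cases "\<bar>t\<bar> \<le> 1")
    case True
    then have "\<bar>t\<bar> powr 2 \<le> 1" by (intro powr_le1) auto
    then show ?thesis using powr_ge_zero[of "\<bar>t\<bar>" p] by linarith
  next
    case False
    then show ?thesis using powr_mono[OF assms(2), of "\<bar>t\<bar>"] by simp
  qed
  have "integrable (lebesgue_on \<Omega>) (\<lambda>x. \<bar>u x\<bar> powr 2)"
  proof (rule Bochner_Integration.integrable_bound)
    show "integrable (lebesgue_on \<Omega>) (\<lambda>x. 1 + \<bar>u x\<bar> powr p)"
      using u by (simp add: Lp_def)
    show "(\<lambda>x. \<bar>u x\<bar> powr 2) \<in> borel_measurable (lebesgue_on \<Omega>)"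
      using u by (auto simp: Lp_def)
    show "AE x in lebesgue_on \<Omega>. norm (\<bar>u x\<bar> powr 2) \<le> norm (1 + \<bar>u x\<bar> powr p)"
      using bound by simp
  qed
  then show "u \<in> L2 \<Omega>" using u by (simp add: Lp_def)
qed

lemma L2_integrable:
  assumes "\<Omega> \<in> lmeasurable" "u \<in> L2 \<Omega>"
  shows "integrable (lebesgue_on \<Omega>) u"
proof -
  interpret finite_measure "lebesgue_on \<Omega>"
    using assms(1) by (rule finite_measure_lebesgue_on)
  have "(\<lambda>_. 1) \<in> L2 \<Omega>"
    by (simp add: L2_iff_square_integrable)
  from L2_mult_integrable[OF assms(2) this] show ?thesis by simp
qed

lemma L2_norm_power2: "(L2_norm \<Omega> u)\<^sup>2 = (\<integral>x. (u x)\<^sup>2 \<partial>lebesgue_on \<Omega>)"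
  by (simp add: L2_norm_def)

lemma L2_norm_power2_ge_tangent:
  assumes "r \<in> L2 \<Omega>" "s \<in> L2 \<Omega>"
  shows "2 * L2_inner \<Omega> s (\<lambda>x. r x - s x) \<le> (L2_norm \<Omega> r)\<^sup>2 - (L2_norm \<Omega> s)\<^sup>2"
proof -
  have r2: "integrable (lebesgue_on \<Omega>) (\<lambda>x. (r x)\<^sup>2)"
    and s2: "integrable (lebesgue_on \<Omega>) (\<lambda>x. (s x)\<^sup>2)"
    using assms by (auto simp: L2_iff_square_integrable)
  have "2 * L2_inner \<Omega> s (\<lambda>x. r x - s x) = (\<integral>x. 2 * (s x * (r x - s x)) \<partial>lebesgue_on \<Omega>)"
    by (simp add: L2_inner_def)
  also have "\<dots> \<le> (\<integral>x. (r x)\<^sup>2 - (s x)\<^sup>2 \<partial>lebesgue_on \<Omega>)"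
  proof (rule integral_mono)
    show "integrable (lebesgue_on \<Omega>) (\<lambda>x. 2 * (s x * (r x - s x)))"
      using L2_mult_integrable[OF assms(2) L2_diff[OF assms]] by simp
    show "2 * (s x * (r x - s x)) \<le> (r x)\<^sup>2 - (s x)\<^sup>2" for x
      using zero_le_power2[of "r x - s x"] by (simp add: power2_eq_square algebra_simps)
  qed (use r2 s2 in simp)
  finally show ?thesis using r2 s2 by (simp add: L2_norm_power2)
qed

lemma Linf_ball_AE:
  assumes "v \<in> Linf_ball \<Omega> r u"
  shows "AE x in lebesgue_on \<Omega>. \<bar>v x - u x\<bar> \<le> r"
proof -
  have "AE x in lebesgue_on \<Omega>. ereal \<bar>v x - u x\<bar> \<le> Linf_norm \<Omega> (\<lambda>x. v x - u x)"
    unfolding Linf_norm_def by (rule esssup_AE)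
  moreover have "Linf_norm \<Omega> (\<lambda>x. v x - u x) \<le> ereal r"
    using assms by (simp add: Linf_ball_def)
  ultimately show ?thesis
    by (auto elim!: eventually_mono dest: order_trans)
qed


section \<open>The adjoint equation\<close>

lemma bilinear_form_transpose:
  "bilinear_form \<Omega> (\<lambda>x. transpose (a x)) c\<^sub>0 y gy v gv = bilinear_form \<Omega> a c\<^sub>0 v gv y gy"
proof -
  have "(\<Sum>i\<in>UNIV. \<Sum>j\<in>UNIV. transpose (a x) $ i $ j * gy x $ j * gv x $ i)
      = (\<Sum>i\<in>UNIV. \<Sum>j\<in>UNIV. a x $ i $ j * gv x $ j * gy x $ i)" for x
    by (subst sum.swap) (simp add: transpose_def ac_simps)
  then show ?thesis by (simp add: bilinear_form_def ac_simps)
qed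

text \<open>Each equation is tested with the solution of the other, and the two bilinear forms then agree.
  This trades the derivative of the tracking term in the state for one in the control.\<close>

lemma adjoint_duality:
  assumes "weak_solution \<Omega> a c\<^sub>0 w y" "adjoint_weak_solution \<Omega> a c\<^sub>0 r \<phi>"
  shows "L2_inner \<Omega> r y = L2_inner \<Omega> w \<phi>"
proof -
  obtain gy where y: "y \<in> H01 \<Omega>" "has_weak_gradient \<Omega> y gy"
    and y_eq: "\<And>v gv. v \<in> H01 \<Omega> \<Longrightarrow> has_weak_gradient \<Omega> v gv \<Longrightarrow>
      bilinear_form \<Omega> a c\<^sub>0 y gy v gv = L2_inner \<Omega> w v"
    using assms(1) unfolding weak_solution_def by blast
  obtain g\<phi> where \<phi>: "\<phi> \<in> H01 \<Omega>" "has_weak_gradient \<Omega> \<phi> g\<phi>"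
    and \<phi>_eq: "\<And>v gv. v \<in> H01 \<Omega> \<Longrightarrow> has_weak_gradient \<Omega> v gv \<Longrightarrow>
      bilinear_form \<Omega> (\<lambda>x. transpose (a x)) c\<^sub>0 \<phi> g\<phi> v gv = L2_inner \<Omega> r v"
    using assms(2) unfolding adjoint_weak_solution_def weak_solution_def by blast
  show ?thesis
    using y_eq[OF \<phi>] \<phi>_eq[OF y] by (simp add: bilinear_form_transpose)
qed

lemma weak_solution_L2: "weak_solution \<Omega> a c\<^sub>0 w y \<Longrightarrow> y \<in> L2 \<Omega>"
  by (simp add: weak_solution_def H01_def H1_def)

text \<open>The squared norm is convex, so its increment is at least the pairing of the residual
  \<open>state S f u_bar - y\<^sub>d\<close> with \<open>S u - S u_bar\<close>.  Duality, applied to \<open>S u\<close> and to \<open>S u_bar\<close>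
  separately, turns this into the pairing of \<open>\<phi>\<close> with \<open>u - u_bar\<close>.\<close>

lemma tracking_term_ge_linearization:
  assumes S: "solution_operator \<Omega> a c\<^sub>0 S"
    and L2: "u \<in> L2 \<Omega>" "u_bar \<in> L2 \<Omega>" "f \<in> L2 \<Omega>" "y\<^sub>d \<in> L2 \<Omega>"
    and \<phi>: "adjoint_weak_solution \<Omega> a c\<^sub>0 (\<lambda>x. state S f u_bar x - y\<^sub>d x) \<phi>"
  shows "2 * L2_inner \<Omega> \<phi> (\<lambda>x. u x - u_bar x)
    \<le> (L2_norm \<Omega> (\<lambda>x. state S f u x - y\<^sub>d x))\<^sup>2 - (L2_norm \<Omega> (\<lambda>x. state S f u_bar x - y\<^sub>d x))\<^sup>2"
proof -
  let ?r = "\<lambda>x. state S f u_bar x - y\<^sub>d x"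
  have sol: "weak_solution \<Omega> a c\<^sub>0 w (S w)" if "w \<in> L2 \<Omega>" for w
    using S that by (simp add: solution_operator_def)
  note SL2 = weak_solution_L2[OF sol]
  have \<phi>L2: "\<phi> \<in> L2 \<Omega>"
    using \<phi> weak_solution_L2 unfolding adjoint_weak_solution_def by blast
  have stateL2: "(\<lambda>x. state S f w x - y\<^sub>d x) \<in> L2 \<Omega>" if "w \<in> L2 \<Omega>" for w
    unfolding state_def by (intro L2_diff L2_add SL2 that L2)
  have "L2_inner \<Omega> ?r (\<lambda>x. (state S f u x - y\<^sub>d x) - ?r x)
      = L2_inner \<Omega> ?r (S u) - L2_inner \<Omega> ?r (S u_bar)"
    using L2_mult_integrable[OF stateL2 SL2, OF L2(2) L2(1)]
      L2_mult_integrable[OF stateL2 SL2, OF L2(2) L2(2)]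
    by (simp add: L2_inner_def state_def right_diff_distrib)
  also have "\<dots> = L2_inner \<Omega> u \<phi> - L2_inner \<Omega> u_bar \<phi>"
    using adjoint_duality[OF sol \<phi>] L2 by simp
  also have "\<dots> = L2_inner \<Omega> \<phi> (\<lambda>x. u x - u_bar x)"
    using L2_mult_integrable[OF \<phi>L2 L2(1)] L2_mult_integrable[OF \<phi>L2 L2(2)]
    by (simp add: L2_inner_def right_diff_distrib mult.commute[of _ "\<phi> _"])
  finally show ?thesis
    using L2_norm_power2_ge_tangent[OF stateL2 stateL2, OF L2(1) L2(2)] by simp
qed


section \<open>The regularized sparsity term\<close>

lemma powr_ge_tangent_minus_square:
  fixes q c s t :: real
  assumes "0 < q" "q < 1" "0 < c" "c \<le> s" "c \<le> t"
  shows "t powr q - s powr q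
    \<ge> q * s powr (q - 1) * (t - s) - q * (1 - q) * c powr (q - 2) / 2 * (t - s)\<^sup>2"
proof -
  define k where "k = q * (1 - q) * c powr (q - 2)"
  \<comment> \<open>Adding this parabola makes the concave power convex on the half-line above \<open>c\<close>.\<close>
  have "(q * s powr (q - 1) + k * s) * (t - s)
      \<le> (t powr q + k / 2 * t\<^sup>2) - (s powr q + k / 2 * s\<^sup>2)"
  proof (rule f''_imp_f'[where C = "{c..}" and f'' = "\<lambda>x. q * ((q - 1) * x powr (q - 2)) + k"])
    fix x assume "x \<in> {c..}"
    then have x: "0 < x" "c \<le> x" using assms by auto
    show "((\<lambda>x. x powr q + k / 2 * x\<^sup>2) has_real_derivative q * x powr (q - 1) + k * x) (at x)"
      using x by (auto intro!: derivative_eq_intros)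
    show "((\<lambda>x. q * x powr (q - 1) + k * x) has_real_derivative
        q * ((q - 1) * x powr (q - 2)) + k) (at x)"
      using x by (auto intro!: derivative_eq_intros)
    have "x powr (q - 2) \<le> c powr (q - 2)"
      using x assms by (intro powr_mono2') auto
    then have "(q * (1 - q)) * x powr (q - 2) \<le> (q * (1 - q)) * c powr (q - 2)"
      using assms by (intro mult_left_mono) auto
    then show "0 \<le> q * ((q - 1) * x powr (q - 2)) + k"
      by (simp add: k_def algebra_simps)
  qed (use assms in auto)
  then show ?thesis
    unfolding k_def[symmetric] by (simp add: power2_eq_square algebra_simps)
qed

lemma h_reg_powr_small:
  assumes "0 < q" "0 < \<gamma>" "\<bar>t\<bar> \<le> 1 / \<gamma>"
  shows "h_reg q \<gamma> t powr q = delta q \<gamma> * \<bar>t\<bar>"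
  using assms by (simp add: h_reg_def delta_def powr_mult powr_powr)

lemma h_reg_powr_large:
  assumes "1 / \<gamma> < \<bar>t\<bar>"
  shows "h_reg q \<gamma> t powr q = (\<bar>t\<bar> - (1 - q) / \<gamma>) powr q"
  using assms by (simp add: h_reg_def)

text \<open>The function \<open>j_reg\<close> is the derivative of the difference between the convex function
  \<open>delta q \<gamma> * \<bar>s\<bar>\<close> and the sparsity term.  Beyond \<open>1 / \<gamma>\<close> the slope of the convex part cancels, and
  the subgradient in the optimality system is the derivative of the sparsity term.\<close>

lemma delta_sgn_minus_j_reg:
  assumes "1 / \<gamma> < \<bar>s\<bar>"
  shows "delta q \<gamma> * sgn s - j_reg q \<gamma> s = q * (\<bar>s\<bar> - (1 - q) / \<gamma>) powr (q - 1) * sgn s"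
proof -
  have "\<bar>s\<bar> + (q - 1) / \<gamma> = \<bar>s\<bar> - (1 - q) / \<gamma>"
    by (simp add: diff_divide_distrib)
  then show ?thesis using assms by (simp add: j_reg_def left_diff_distrib)
qed

lemma sgn_mult_diff_le: "sgn s * (t - s) \<le> \<bar>t\<bar> - \<bar>s\<bar>" for s t :: real
  by (cases s "0 :: real" rule: linorder_cases) auto

text \<open>The sparsity term is even, so Taylor's formula for the power is applied to the moduli.
  Passing back to \<open>t - s\<close> only weakens the inequality, whatever the signs of \<open>s\<close> and \<open>t\<close>: the slope
  in \<open>\<bar>s\<bar>\<close> is nonnegative and \<open>sgn s * (t - s) \<le> \<bar>t\<bar> - \<bar>s\<bar>\<close>, while \<open>(\<bar>t\<bar> - \<bar>s\<bar>)\<^sup>2 \<le> (t - s)\<^sup>2\<close>.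
  The bound on \<open>c\<close> places both points beyond \<open>1 / \<gamma>\<close>.\<close>

lemma h_reg_powr_growth_away_from_zero:
  assumes q: "0 < q" "q < 1" and "0 < \<gamma>" and c: "q / \<gamma> < c"
    and s: "c + (1 - q) / \<gamma> \<le> \<bar>s\<bar>" and t: "c + (1 - q) / \<gamma> \<le> \<bar>t\<bar>"
  shows "h_reg q \<gamma> t powr q - h_reg q \<gamma> s powr q
    \<ge> (delta q \<gamma> * sgn s - j_reg q \<gamma> s) * (t - s) - q * (1 - q) * c powr (q - 2) / 2 * (t - s)\<^sup>2"
proof -
  define S T where "S = \<bar>s\<bar> - (1 - q) / \<gamma>" and "T = \<bar>t\<bar> - (1 - q) / \<gamma>"
  have "0 < q / \<gamma>" using q \<open>0 < \<gamma>\<close> by simp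
  then have cST: "0 < c" "c \<le> S" "c \<le> T"
    using c s t by (auto simp: S_def T_def)
  have "1 / \<gamma> < c + (1 - q) / \<gamma>" using c by (simp add: diff_divide_distrib)
  then have large: "1 / \<gamma> < \<bar>s\<bar>" "1 / \<gamma> < \<bar>t\<bar>" using s t by auto
  have "(\<bar>t\<bar> - \<bar>s\<bar>)\<^sup>2 \<le> (t - s)\<^sup>2"
    using abs_triangle_ineq3[of t s] by (simp add: abs_le_square_iff)
  then have square: "q * (1 - q) * c powr (q - 2) / 2 * (\<bar>t\<bar> - \<bar>s\<bar>)\<^sup>2
      \<le> q * (1 - q) * c powr (q - 2) / 2 * (t - s)\<^sup>2"
    using q by (intro mult_left_mono) auto
  have linear: "q * S powr (q - 1) * (sgn s * (t - s)) \<le> q * S powr (q - 1) * (\<bar>t\<bar> - \<bar>s\<bar>)"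
    using q by (intro mult_left_mono sgn_mult_diff_le) auto
  have "T powr q - S powr q
      \<ge> q * S powr (q - 1) * (\<bar>t\<bar> - \<bar>s\<bar>) - q * (1 - q) * c powr (q - 2) / 2 * (\<bar>t\<bar> - \<bar>s\<bar>)\<^sup>2"
    using powr_ge_tangent_minus_square[OF q cST] by (simp add: S_def T_def)
  then show ?thesis
    using square linear
    by (simp add: h_reg_powr_large delta_sgn_minus_j_reg large flip: S_def T_def mult.assoc)
qed

lemma h_reg_powr_growth_at_zero:
  assumes "0 < q" "0 < \<gamma>" "\<bar>t\<bar> \<le> 1 / \<gamma>" "\<bar>z\<bar> \<le> 1"
  shows "delta q \<gamma> * z * t \<le> h_reg q \<gamma> t powr q"
proof -
  have "0 \<le> delta q \<gamma>" by (simp add: delta_def)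
  moreover have "z * t \<le> \<bar>t\<bar>"
    using abs_ge_self[of "z * t"] mult_right_mono[OF assms(4), of "\<bar>t\<bar>"] by (simp add: abs_mult)
  ultimately show ?thesis
    using h_reg_powr_small[OF assms(1-3)] by (simp add: mult.assoc mult_left_mono)
qed

lemma h_reg_powr_integrable:
  assumes "\<Omega> \<in> lmeasurable" "u \<in> L2 \<Omega>" "0 < q" "q < 1" "0 < \<gamma>"
  shows "integrable (lebesgue_on \<Omega>) (\<lambda>x. h_reg q \<gamma> (u x) powr q)"
proof (rule Bochner_Integration.integrable_bound)
  interpret finite_measure "lebesgue_on \<Omega>"
    using assms(1) by (rule finite_measure_lebesgue_on)
  have u[measurable]: "u \<in> borel_measurable (lebesgue_on \<Omega>)"
    using assms(2) by (simp add: Lp_def)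
  show "integrable (lebesgue_on \<Omega>) (\<lambda>x. (delta q \<gamma> + 1) * \<bar>u x\<bar> + 1)"
    using L2_integrable[OF assms(1,2)] by simp
  show "(\<lambda>x. h_reg q \<gamma> (u x) powr q) \<in> borel_measurable (lebesgue_on \<Omega>)"
    unfolding h_reg_def by measurable
  have "h_reg q \<gamma> t powr q \<le> (delta q \<gamma> + 1) * \<bar>t\<bar> + 1" for t
  proof (cases "\<bar>t\<bar> \<le> 1 / \<gamma>")
    case True
    then show ?thesis using h_reg_powr_small[of q \<gamma> t] assms by (simp add: algebra_simps)
  next
    case False
    then have large: "1 / \<gamma> < \<bar>t\<bar>" by simp
    moreover have "(1 - q) / \<gamma> < 1 / \<gamma>" "0 < (1 - q) / \<gamma>"
      using assms by (auto simp: divide_simps)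
    ultimately have m: "0 \<le> \<bar>t\<bar> - (1 - q) / \<gamma>" "\<bar>t\<bar> - (1 - q) / \<gamma> \<le> 1 + \<bar>t\<bar>" by auto
    have "(\<bar>t\<bar> - (1 - q) / \<gamma>) powr q \<le> (1 + \<bar>t\<bar>) powr q"
      using m assms by (intro powr_mono2) auto
    also have "\<dots> \<le> (1 + \<bar>t\<bar>) powr 1"
      using assms by (intro powr_mono) auto
    finally have "h_reg q \<gamma> t powr q \<le> 1 + \<bar>t\<bar>" by (simp add: h_reg_powr_large large)
    moreover have "0 \<le> delta q \<gamma> * \<bar>t\<bar>" by (simp add: delta_def)
    ultimately show ?thesis by (simp add: algebra_simps)
  qed
  then show "AE x in lebesgue_on \<Omega>.
      norm (h_reg q \<gamma> (u x) powr q) \<le> norm ((delta q \<gamma> + 1) * \<bar>u x\<bar> + 1)"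
    by (auto simp: intro: order_trans[OF _ abs_ge_self])
qed


section \<open>Quadratic growth\<close>

lemma s_star_pos: "0 < \<alpha> \<Longrightarrow> 0 < \<beta> \<Longrightarrow> 0 < q \<Longrightarrow> q < 1 \<Longrightarrow> 0 < s_star \<alpha> \<beta> q"
  by (simp add: s_star_def)

text \<open>\<open>s_star\<close> is the point \<open>s\<close> at which the concavity \<open>\<beta> * q * (1 - q) * s powr (q - 2)\<close> of
  \<open>\<beta> * s powr q\<close> equals the convexity \<open>\<alpha>\<close> of the control cost; beyond it the latter dominates.\<close>

lemma curvature_at_multiple_of_s_star:
  assumes "0 < \<alpha>" "0 < \<beta>" "0 < q" "q < 1" "0 < c"
  shows "\<beta> * (q * (1 - q) * (c * s_star \<alpha> \<beta> q) powr (q - 2)) = \<alpha> * c powr (q - 2)"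
proof -
  let ?b = "\<beta> / \<alpha> * (q * (1 - q))"
  have "1 / (2 - q) * (q - 2) = -1" using assms by (simp add: field_simps)
  then have "s_star \<alpha> \<beta> q powr (q - 2) = ?b powr - 1"
    unfolding s_star_def powr_powr by (rule arg_cong)
  also have "\<dots> = 1 / ?b"
    using assms by (simp add: powr_minus_divide)
  finally have "(c * s_star \<alpha> \<beta> q) powr (q - 2) = c powr (q - 2) * (1 / ?b)"
    by (simp add: powr_mult)
  then show ?thesis using assms by (simp add: field_simps)
qed

text \<open>Here \<open>s\<close> and \<open>t\<close> stand for the values of \<open>u_bar\<close> and \<open>u\<close> at a point, \<open>p\<close> and \<open>z\<close> for those of
  the adjoint state and the subgradient, and \<open>m\<close> and \<open>n\<close> for those of the multipliers.  Complementarity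
  gives \<open>(m - n) * (t - s)\<close> the favourable sign.  If \<open>s \<noteq> 0\<close>, then \<open>s\<close> and \<open>t\<close> both lie beyond
  \<open>c * s_star + (1 - q) / \<gamma>\<close> in modulus, where the concavity of the sparsity term uses up only the
  fraction \<open>c powr (q - 2)\<close> of the control cost.  If \<open>s = 0\<close>, the kink \<open>delta q \<gamma> * \<bar>t\<bar>\<close> absorbs
  every subgradient \<open>z\<close>.\<close>

lemma pointwise_growth:
  fixes \<alpha> \<beta> q \<gamma> c s t z p m n u\<^sub>a u\<^sub>b :: real
  assumes pos: "0 < \<alpha>" "0 < \<beta>" "0 < q" "q < 1" "1 < c"
    and \<gamma>: "0 < \<gamma>" "1 / \<gamma> < s_star \<alpha> \<beta> q"
    and eq: "p + \<alpha> * s + \<beta> * (delta q \<gamma> * z - j_reg q \<gamma> s) + n - m = 0"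
    and mult: "0 \<le> m" "0 \<le> n" "m * (s - u\<^sub>a) = 0" "n * (u\<^sub>b - s) = 0"
    and z: "0 < s \<longrightarrow> z = 1" "s < 0 \<longrightarrow> z = -1" "s = 0 \<longrightarrow> \<bar>z\<bar> \<le> 1"
    and s: "s \<noteq> 0 \<longrightarrow> c * s_star \<alpha> \<beta> q + r + (1 - q) / \<gamma> \<le> \<bar>s\<bar>"
    and t: "u\<^sub>a \<le> t" "t \<le> u\<^sub>b" "\<bar>t - s\<bar> \<le> r" "r \<le> 1 / \<gamma>"
  shows "\<alpha> / 2 * (1 - c powr (q - 2)) * (t - s)\<^sup>2
    \<le> p * (t - s) + \<alpha> / 2 * (t\<^sup>2 - s\<^sup>2) + \<beta> * (h_reg q \<gamma> t powr q - h_reg q \<gamma> s powr q)"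
proof -
  let ?D = "h_reg q \<gamma> t powr q - h_reg q \<gamma> s powr q"
  let ?\<xi> = "delta q \<gamma> * z - j_reg q \<gamma> s"
  have sign: "0 \<le> (m - n) * (t - s)"
  proof -
    have "0 \<le> m * (t - s)" using mult(1,3) t(1) by auto
    moreover have "n * (t - s) \<le> 0" using mult(2,4) t(2) by (auto simp: mult_le_0_iff)
    ultimately show ?thesis by (simp add: left_diff_distrib)
  qed
  have p: "p = m - n - \<alpha> * s - \<beta> * ?\<xi>" using eq by linarith
  have expand: "p * (t - s) + \<alpha> / 2 * (t\<^sup>2 - s\<^sup>2) + \<beta> * ?D
      = \<alpha> / 2 * (t - s)\<^sup>2 + \<beta> * (?D - ?\<xi> * (t - s)) + (m - n) * (t - s)"
    unfolding p by (simp add: power2_eq_square field_simps)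
  have "- \<alpha> / 2 * c powr (q - 2) * (t - s)\<^sup>2 \<le> \<beta> * (?D - ?\<xi> * (t - s))"
  proof (cases "s = 0")
    case True
    then have "?\<xi> * (t - s) \<le> ?D"
      using h_reg_powr_growth_at_zero[of q \<gamma> t z] pos \<gamma> z(3) t by (simp add: j_reg_def h_reg_def)
    moreover have "- \<alpha> / 2 * c powr (q - 2) * (t - s)\<^sup>2 \<le> 0"
      using pos by (simp add: mult_nonneg_nonneg)
    ultimately show ?thesis
      using pos by (meson diff_ge_0_iff_ge less_imp_le mult_nonneg_nonneg order_trans)
  next
    case False
    let ?c = "c * s_star \<alpha> \<beta> q"
    have zs: "z = sgn s" using z False by (auto simp: sgn_if)
    have "q / \<gamma> < 1 / \<gamma>" using pos \<gamma> by (simp add: divide_strict_right_mono)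
    also have "\<dots> < s_star \<alpha> \<beta> q" by (fact \<gamma>)
    also have "\<dots> \<le> ?c" using pos s_star_pos[of \<alpha> \<beta> q] by simp
    finally have qc: "q / \<gamma> < ?c" .
    have "?c + (1 - q) / \<gamma> \<le> \<bar>s\<bar>" "?c + (1 - q) / \<gamma> \<le> \<bar>t\<bar>"
      using s False t(3) by auto
    from h_reg_powr_growth_away_from_zero[OF pos(3,4) \<gamma>(1) qc this]
    have "- (q * (1 - q) * ?c powr (q - 2)) / 2 * (t - s)\<^sup>2 \<le> ?D - ?\<xi> * (t - s)"
      unfolding zs by simp
    then have "\<beta> * (- (q * (1 - q) * ?c powr (q - 2)) / 2 * (t - s)\<^sup>2) \<le> \<beta> * (?D - ?\<xi> * (t - s))"
      using pos by (intro mult_left_mono) auto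
    moreover have "\<beta> * (- (q * (1 - q) * ?c powr (q - 2)) / 2 * (t - s)\<^sup>2)
        = - (\<beta> * (q * (1 - q) * ?c powr (q - 2))) / 2 * (t - s)\<^sup>2"
      by simp
    moreover have "\<beta> * (q * (1 - q) * ?c powr (q - 2)) = \<alpha> * c powr (q - 2)"
      using pos by (intro curvature_at_multiple_of_s_star) auto
    ultimately show ?thesis by (simp only: minus_divide_left mult_minus_left times_divide_eq_left)
  qed
  then show ?thesis
    unfolding expand using sign by (simp add: algebra_simps)
qed

theorem theorem3:
  fixes \<Omega> :: "(real^2) set"
    and a :: "real^2 \<Rightarrow> real^2^2"
    and c\<^sub>0 f y\<^sub>d :: "real^2 \<Rightarrow> real"
    and S S_adj :: "(real^2 \<Rightarrow> real) \<Rightarrow> real^2 \<Rightarrow> real"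
    and p \<alpha> \<beta> q u\<^sub>a u\<^sub>b C :: real
  assumes "open \<Omega>" "bounded \<Omega>" "starlike \<Omega>"
    and "\<forall>i j. continuous_on (closure \<Omega>) (\<lambda>x. a x $ i $ j)"
    and "\<forall>x\<in>closure \<Omega>. transpose (a x) = a x"
    and "uniformly_elliptic \<Omega> a"
    and "c\<^sub>0 \<in> Linf \<Omega>" "AE x in lebesgue_on \<Omega>. 0 \<le> c\<^sub>0 x"
    and "2 < p" "y\<^sub>d \<in> Lp \<Omega> p"
    and "f \<in> L2 \<Omega>"
    and "0 < \<alpha>" "0 < \<beta>" "0 < q" "q < 1"
    and "u\<^sub>a < 0" "0 < u\<^sub>b"
    and "solution_operator \<Omega> a c\<^sub>0 S" "bounded_L2_Linf \<Omega> S"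
    and "L2_adjoint \<Omega> S S_adj" "bounded_L2_Linf \<Omega> S_adj"
    and "1 < C"
  shows "\<exists>\<gamma>\<^sub>0>0. \<forall>\<gamma>>\<gamma>\<^sub>0. 1 < \<gamma> \<longrightarrow>
    (\<forall>u_bar \<in> U_ad \<Omega> u\<^sub>a u\<^sub>b.
      (\<exists>\<phi> \<zeta> \<mu>\<^sub>a \<mu>\<^sub>b. KKT \<Omega> a c\<^sub>0 S f y\<^sub>d \<alpha> \<beta> q \<gamma> u\<^sub>a u\<^sub>b u_bar \<phi> \<zeta> \<mu>\<^sub>a \<mu>\<^sub>b) \<longrightarrow>
      (AE x in lebesgue_on \<Omega>. u_bar x \<noteq> 0 \<longrightarrow> \<bar>u_bar x\<bar> \<ge> C * s_star \<alpha> \<beta> q + (1 - q) / \<gamma>) \<longrightarrow>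
      (\<exists>\<rho>>0. \<exists>\<sigma>>0. \<forall>u \<in> Linf_ball \<Omega> \<rho> u_bar \<inter> U_ad \<Omega> u\<^sub>a u\<^sub>b.
        \<sigma> * (L2_norm \<Omega> (\<lambda>x. u x - u_bar x))\<^sup>2
          \<le> cost \<Omega> S f y\<^sub>d \<alpha> \<beta> q \<gamma> u - cost \<Omega> S f y\<^sub>d \<alpha> \<beta> q \<gamma> u_bar))"
proof -
  define s where "s = s_star \<alpha> \<beta> q"
  define c where "c = (1 + C) / 2"
  have s_pos: "0 < s" using assms by (simp add: s_def s_star_pos)
  have c: "1 < c" using \<open>1 < C\<close> by (simp add: c_def)
  have \<Omega>: "\<Omega> \<in> lmeasurable"
    using assms(1,2) by (simp add: lmeasurable_open)
  have y\<^sub>d: "y\<^sub>d \<in> L2 \<Omega>"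
    using Lp_subset_L2[OF \<Omega>, of p] assms by auto
  show ?thesis
  proof (rule exI[of _ "1 / s"], intro conjI allI impI ballI)
    show "0 < 1 / s" using s_pos by simp
  next
    fix \<gamma> u_bar
    assume \<gamma>: "1 / s < \<gamma>" "1 < \<gamma>" and u_bar: "u_bar \<in> U_ad \<Omega> u\<^sub>a u\<^sub>b"
      and kkt: "\<exists>\<phi> \<zeta> \<mu>\<^sub>a \<mu>\<^sub>b. KKT \<Omega> a c\<^sub>0 S f y\<^sub>d \<alpha> \<beta> q \<gamma> u\<^sub>a u\<^sub>b u_bar \<phi> \<zeta> \<mu>\<^sub>a \<mu>\<^sub>b"
      and gap: "AE x in lebesgue_on \<Omega>.
        u_bar x \<noteq> 0 \<longrightarrow> \<bar>u_bar x\<bar> \<ge> C * s_star \<alpha> \<beta> q + (1 - q) / \<gamma>"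
    obtain \<phi> \<zeta> \<mu>\<^sub>a \<mu>\<^sub>b where KKT: "KKT \<Omega> a c\<^sub>0 S f y\<^sub>d \<alpha> \<beta> q \<gamma> u\<^sub>a u\<^sub>b u_bar \<phi> \<zeta> \<mu>\<^sub>a \<mu>\<^sub>b"
      using kkt by blast
    have adjoint: "adjoint_weak_solution \<Omega> a c\<^sub>0 (\<lambda>x. state S f u_bar x - y\<^sub>d x) \<phi>"
      using KKT by (simp add: KKT_def)
    have \<phi>: "\<phi> \<in> L2 \<Omega>"
      using adjoint weak_solution_L2 unfolding adjoint_weak_solution_def by blast
    have u_bar_L2: "u_bar \<in> L2 \<Omega>" using u_bar by (simp add: U_ad_def)
    have s_gt: "1 / \<gamma> < s_star \<alpha> \<beta> q"
      using \<gamma> s_pos by (simp add: s_def field_simps)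
    \<comment> \<open>The first bound keeps \<open>u\<close> in the kink region where \<open>u_bar\<close> vanishes; the second spends half of
      the margin \<open>C - 1\<close>, leaving the factor \<open>c\<close> in front of \<open>s\<close> where \<open>u_bar\<close> does not.\<close>
    define \<rho> where "\<rho> = min (1 / \<gamma>) ((C - 1) / 2 * s)"
    define \<sigma> where "\<sigma> = \<alpha> / 2 * (1 - c powr (q - 2))"
    have "0 < \<rho>" using \<gamma> s_pos \<open>1 < C\<close> by (simp add: \<rho>_def)
    moreover have "0 < \<sigma>"
      using powr_less_mono[of "q - 2" 0 c] c assms by (simp add: \<sigma>_def)
    moreover have "\<sigma> * (L2_norm \<Omega> (\<lambda>x. u x - u_bar x))\<^sup>2
        \<le> cost \<Omega> S f y\<^sub>d \<alpha> \<beta> q \<gamma> u - cost \<Omega> S f y\<^sub>d \<alpha> \<beta> q \<gamma> u_bar"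
      if u: "u \<in> Linf_ball \<Omega> \<rho> u_bar \<inter> U_ad \<Omega> u\<^sub>a u\<^sub>b" for u
    proof -
      let ?M = "lebesgue_on \<Omega>"
      let ?D = "\<lambda>x. h_reg q \<gamma> (u x) powr q - h_reg q \<gamma> (u_bar x) powr q"
      have u_L2: "u \<in> L2 \<Omega>" using u by (simp add: U_ad_def)
      have close: "AE x in ?M. \<bar>u x - u_bar x\<bar> \<le> \<rho>"
        using u by (intro Linf_ball_AE) auto
      have bounds: "AE x in ?M. u\<^sub>a \<le> u x \<and> u x \<le> u\<^sub>b"
        using u by (simp add: U_ad_def)
      have "AE x in ?M.
          \<phi> x + \<alpha> * u_bar x + \<beta> * (delta q \<gamma> * \<zeta> x - j_reg q \<gamma> (u_bar x)) + \<mu>\<^sub>b x - \<mu>\<^sub>a x = 0 \<and>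
          \<mu>\<^sub>a x \<ge> 0 \<and> \<mu>\<^sub>b x \<ge> 0 \<and> \<mu>\<^sub>a x * (u_bar x - u\<^sub>a) = 0 \<and> \<mu>\<^sub>b x * (u\<^sub>b - u_bar x) = 0 \<and>
          (u_bar x > 0 \<longrightarrow> \<zeta> x = 1) \<and> (u_bar x < 0 \<longrightarrow> \<zeta> x = -1) \<and> (u_bar x = 0 \<longrightarrow> \<bar>\<zeta> x\<bar> \<le> 1)"
        using KKT by (simp add: KKT_def)
      from this close bounds gap
      have growth: "AE x in ?M. \<sigma> * (u x - u_bar x)\<^sup>2
          \<le> \<phi> x * (u x - u_bar x) + \<alpha> / 2 * ((u x)\<^sup>2 - (u_bar x)\<^sup>2) + \<beta> * ?D x"
      proof eventually_elim
        case (elim x)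
        have "c * s + \<rho> \<le> C * s"
          using s_pos by (simp add: c_def \<rho>_def min_def field_simps)
        then have "u_bar x \<noteq> 0 \<longrightarrow> c * s_star \<alpha> \<beta> q + \<rho> + (1 - q) / \<gamma> \<le> \<bar>u_bar x\<bar>"
          using elim(4) by (auto simp: s_def)
        moreover have "\<rho> \<le> 1 / \<gamma>" by (simp add: \<rho>_def)
        moreover have "0 < \<gamma>" using \<gamma> by simp
        ultimately show ?case
          unfolding \<sigma>_def using elim
          by (intro pointwise_growth[where z = "\<zeta> x" and m = "\<mu>\<^sub>a x" and n = "\<mu>\<^sub>b x"
                and u\<^sub>a = u\<^sub>a and u\<^sub>b = u\<^sub>b and r = \<rho>] assms c s_gt) auto
      qed
      have diff_L2: "(\<lambda>x. u x - u_bar x) \<in> L2 \<Omega>" by (rule L2_diff[OF u_L2 u_bar_L2])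
      have int_diff: "integrable ?M (\<lambda>x. (u x - u_bar x)\<^sup>2)"
        and int_u: "integrable ?M (\<lambda>x. (u x)\<^sup>2)"
        and int_u_bar: "integrable ?M (\<lambda>x. (u_bar x)\<^sup>2)"
        using diff_L2 u_L2 u_bar_L2 by (auto simp: L2_iff_square_integrable)
      have int_\<phi>: "integrable ?M (\<lambda>x. \<phi> x * (u x - u_bar x))"
        by (rule L2_mult_integrable[OF \<phi> diff_L2])
      have int_h: "integrable ?M (\<lambda>x. h_reg q \<gamma> (u x) powr q)"
        "integrable ?M (\<lambda>x. h_reg q \<gamma> (u_bar x) powr q)"
        using h_reg_powr_integrable[OF \<Omega> u_L2] h_reg_powr_integrable[OF \<Omega> u_bar_L2] assms \<gamma> by auto
      have "\<sigma> * (L2_norm \<Omega> (\<lambda>x. u x - u_bar x))\<^sup>2 = (\<integral>x. \<sigma> * (u x - u_bar x)\<^sup>2 \<partial>?M)"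
        by (simp add: L2_norm_power2)
      also have "\<dots> \<le> (\<integral>x. \<phi> x * (u x - u_bar x) + \<alpha> / 2 * ((u x)\<^sup>2 - (u_bar x)\<^sup>2) + \<beta> * ?D x \<partial>?M)"
        using int_diff int_u int_u_bar int_\<phi> int_h growth by (intro integral_mono_AE) auto
      also have "\<dots> = L2_inner \<Omega> \<phi> (\<lambda>x. u x - u_bar x)
          + \<alpha> / 2 * ((L2_norm \<Omega> u)\<^sup>2 - (L2_norm \<Omega> u_bar)\<^sup>2)
          + \<beta> * (Upsilon \<Omega> q \<gamma> u - Upsilon \<Omega> q \<gamma> u_bar)"
        using int_u int_u_bar int_\<phi> int_h by (simp add: L2_inner_def L2_norm_power2 Upsilon_def)
      also have "\<dots> \<le> cost \<Omega> S f y\<^sub>d \<alpha> \<beta> q \<gamma> u - cost \<Omega> S f y\<^sub>d \<alpha> \<beta> q \<gamma> u_bar"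
        using tracking_term_ge_linearization[OF _ u_L2 u_bar_L2 _ y\<^sub>d adjoint] assms
        by (simp add: cost_def algebra_simps)
      finally show ?thesis .
    qed
    ultimately show "\<exists>\<rho>>0. \<exists>\<sigma>>0. \<forall>u \<in> Linf_ball \<Omega> \<rho> u_bar \<inter> U_ad \<Omega> u\<^sub>a u\<^sub>b.
        \<sigma> * (L2_norm \<Omega> (\<lambda>x. u x - u_bar x))\<^sup>2
          \<le> cost \<Omega> S f y\<^sub>d \<alpha> \<beta> q \<gamma> u - cost \<Omega> S f y\<^sub>d \<alpha> \<beta> q \<gamma> u_bar"
      by blast
  qed
qed

end
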